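(* Let $(\mathfrak P,\mathfrak T,\mathfrak e)$ be a state system (as defined in the context) with poset of states $(\mathfrak S,\sqsubseteq)$. Then $(\mathfrak S,\sqsubseteq)$ is a projective domain; that is, $\mathfrak S$ is directed complete, bounded complete, atomistic, meet-continuous, algebraic, relatively complemented and conditionally modular.
   Context: Let $\mathfrak B=\{\bot,\mathbf Y,\mathbf N\}$ with partial order $u\le v$ iff $u=\bot$ or $u=v$, and involution $\overline{\bot}=\bot$, $\overline{\mathbf Y}=\mathbf N$, $\overline{\mathbf N}=\mathbf Y$. The data are: sets $\mathfrak P$ (preparations) and $\mathfrak T$ (yes/no tests), a map $\mathfrak e:\mathfrak P\times\mathfrak T\to\mathfrak B$, and a map $\mathfrak t\mapsto\overline{\mathfrak t}$ on $\mathfrak T$ with $\mathfrak e(\mathfrak p,\overline{\mathfrak t})=\overline{\mathfrak e(\mathfrak p,\mathfrak t)}$ for all $\mathfrak p,\mathfrak t$. Put $\mathfrak p_1\sim\mathfrak p_2$ iff $\mathfrak e(\mathfrak p_1,\mathfrak t)=\mathfrak e(\mathfrak p_2,\mathfrak t)$ for all $\mathfrak t$; $\mathfrak S=\mathfrak P/\sim$ is the set of states, $\lceil\mathfrak p\rceil$ is the class of $\mathfrak p$, $\widetilde{\mathfrak e}_{\mathfrak t}(\lceil\mathfrak p\rceil)=\mathfrak e(\mathfrak p,\mathfrak t)$, and $\sigma_1\sqsubseteq\sigma_2$ iff $\widetilde{\mathfrak e}_{\mathfrak t}(\sigma_1)\le\widetilde{\mathfrak e}_{\mathfrak t}(\sigma_2)$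 for all $\mathfrak t\in\mathfrak T$ (a partial order on $\mathfrak S$). $\sqcap,\inf$ and $\sqcup,\bigsqcup$ are infima and (when they exist) suprema in $\mathfrak S$; $\sigma\sqsubset\tau$ means $\sigma\sqsubseteq\tau$, $\sigma\ne\tau$; $\sigma\lessdot\tau$ means that $\tau$ covers $\sigma$ ($\sigma\sqsubset\tau$ with nothing strictly between). A state system is such data satisfying: (A1) for every nonempty $P\subseteq\mathfrak P$ there is a unique element of $\mathfrak P$, denoted $\inf P$, with $\mathfrak e(\inf P,\mathfrak t)=\bigwedge_{\mathfrak p\in P}\mathfrak e(\mathfrak p,\mathfrak t)$ for all $\mathfrak t$; (A2) there is a unique $\mathfrak p_\bot\in\mathfrak P$ with $\mathfrak e(\mathfrak p_\bot,\mathfrak t)=\bot$ for all $\mathfrak t$ (so $\bot_{\mathfrak S}=\lceil\mathfrak p_\bot\rceil$ is the bottom of $\mathfrak S$); (A3) every nonempty chain in $\mathfrak S$ has a supremum in $\mathfrak S$; (A4) for every $\mathfrak t\in\mathfrak T$ and every nonempty chain $\mathfrak C\subseteq\mathfrak S$, if $\widetilde{\mathfrak e}_{\mathfrak t}(\bigsqcup\mathfrak C)=\mathbf Y$ then $\widetilde{\mathfrak e}_{\mathfrak t}(\sigma)=\mathbf Y$ for some $\sigma\in\mathfrak C$; (A5) if $\sigma\sqsubset\sigma'$ then there is $\sigma''$ with $\sigma\lessdot\sigma''\sqsubseteq\sigma'$; (A6) (a) if $\sigma_1\sqsubseteq\sigma_2\sqsubseteq\sigma_2'$ there is $\sigma_1'$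 with $\sigma_1=\sigma_1'\sqcap\sigma_2$ and $\sigma_2'=\sigma_1'\sqcup\sigma_2$; (b) if $\sigma_1'\sqsubseteq\sigma_2'$, $\sigma_2\lessdot\sigma_2'$ and $\sigma_1'\not\sqsubseteq\sigma_2$, then $(\sigma_1'\sqcap\sigma_2)\lessdot\sigma_1'$; (c) if $\sigma_1\sqsubseteq\sigma_1'\sqsubseteq\sigma_2'$, $\sigma_1\lessdot\sigma_2\sqsubseteq\sigma_2'$ and $\sigma_2\not\sqsubseteq\sigma_1'$, then $\sigma_1'\lessdot(\sigma_1'\sqcup\sigma_2)$. Definitions for a poset $\mathfrak S$ with bottom: bounded complete: every subset having an upper bound has a supremum. Atomistic: every $\sigma$ is the supremum of the atoms (elements covering the bottom) below it. Meet-continuous: $\sigma\sqcap\bigsqcup\mathfrak C=\bigsqcup_{\sigma'\in\mathfrak C}(\sigma\sqcap\sigma')$ for every $\sigma$ and nonempty chain $\mathfrak C$. Algebraic: every element is the supremum of the compact elements below it. Relatively complemented: property (A6)(a). Conditionally modular: for all $\sigma_1,\sigma_2,\sigma_3$ such that $\sigma_2,\sigma_3$ have a common upper bound and $\sigma_1\sqsupseteq\sigma_2$, one has $\sigma_1\sqcap(\sigma_2\sqcup\sigma_3)=\sigma_2\sqcup(\sigma_1\sqcap\sigma_3)$. A projective domain is a directed complete, bounded complete, atomistic, meet-continuous (or algebraic), relatively complemented and conditionally modular poset. *)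

theory Defs
  imports "HOL-Algebra.Lattice"
begin

section \<open>The domain of outcomes\<close>

datatype outcome = Bot | Yes | No

fun flip :: "outcome \<Rightarrow> outcome" where
  "flip Bot = Bot"
| "flip Yes = No"
| "flip No = Yes"

instance outcome :: finite
proof
  have "(UNIV :: outcome set) \<subseteq> {Bot, Yes, No}"
    using outcome.exhaust by blast
  then show "finite (UNIV :: outcome set)"
    by (rule finite_subset) simp
qed

instantiation outcome :: "{order_bot, semilattice_inf}"
begin

definition less_eq_outcome :: "outcome \<Rightarrow> outcome \<Rightarrow> bool" where
  "u \<le> v \<longleftrightarrow> u = Bot \<or> u = v"

definition less_outcome :: "outcome \<Rightarrow> outcome \<Rightarrow> bool" where
  "u < v \<longleftrightarrow> u \<le> v \<and> \<not> v \<le> (u :: outcome)"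

definition bot_outcome :: outcome where
  "bot_outcome = Bot"

definition inf_outcome :: "outcome \<Rightarrow> outcome \<Rightarrow> outcome" where
  "inf_outcome u v = (if u = v then u else Bot)"

instance
  by standard
    (auto simp: less_eq_outcome_def less_outcome_def bot_outcome_def inf_outcome_def)

end


section \<open>Posets with bottom\<close>

text \<open>
  The library's suprema and infima are given by choice and carry no information when they do
  not exist. Below, every supremum or infimum is therefore a witness satisfying
  \<^const>\<open>least\<close> / \<^const>\<open>greatest\<close>, so that an equation between them also
  asserts that both sides exist.
\<close>

definition covers :: "('a, 'b) gorder_scheme \<Rightarrow> 'a \<Rightarrow> 'a \<Rightarrow> bool" (infix \<open>\<lessdot>\<index>\<close> 50) where
  "x \<lessdot>\<^bsub>L\<^esub> y \<longleftrightarrow>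
     x \<in> carrier L \<and> y \<in> carrier L \<and> x \<sqsubset>\<^bsub>L\<^esub> y \<and>
     \<not> (\<exists>z\<in>carrier L. x \<sqsubset>\<^bsub>L\<^esub> z \<and> z \<sqsubset>\<^bsub>L\<^esub> y)"

definition chains :: "('a, 'b) gorder_scheme \<Rightarrow> 'a set set" where
  "chains L = {C. C \<subseteq> carrier L \<and> C \<noteq> {} \<and> Complete_Partial_Order.chain (\<sqsubseteq>\<^bsub>L\<^esub>) C}"

definition directed :: "('a, 'b) gorder_scheme \<Rightarrow> 'a set \<Rightarrow> bool" where
  "directed L D \<longleftrightarrow>
     D \<subseteq> carrier L \<and> D \<noteq> {} \<and> (\<forall>x\<in>D. \<forall>y\<in>D. \<exists>z\<in>D. x \<sqsubseteq>\<^bsub>L\<^esub> z \<and> y \<sqsubseteq>\<^bsub>L\<^esub> z)"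

definition directed_complete :: "('a, 'b) gorder_scheme \<Rightarrow> bool" where
  "directed_complete L \<longleftrightarrow> (\<forall>D. directed L D \<longrightarrow> (\<exists>s. least L s (Upper L D)))"

definition bounded_complete :: "('a, 'b) gorder_scheme \<Rightarrow> bool" where
  "bounded_complete L \<longleftrightarrow>
     (\<forall>A \<subseteq> carrier L. Upper L A \<noteq> {} \<longrightarrow> (\<exists>s. least L s (Upper L A)))"

definition atom :: "('a, 'b) gorder_scheme \<Rightarrow> 'a \<Rightarrow> bool" where
  "atom L a \<longleftrightarrow> \<bottom>\<^bsub>L\<^esub> \<lessdot>\<^bsub>L\<^esub> a"

definition atomistic :: "('a, 'b) gorder_scheme \<Rightarrow> bool" where
  "atomistic L \<longleftrightarrow>
     (\<forall>x\<in>carrier L. least L x (Upper L {a \<in> carrier L. atom L a \<and> a \<sqsubseteq>\<^bsub>L\<^esub> x}))"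

definition meet_continuous :: "('a, 'b) gorder_scheme \<Rightarrow> bool" where
  "meet_continuous L \<longleftrightarrow>
     (\<forall>x\<in>carrier L. \<forall>C\<in>chains L.
        \<exists>s m g. least L s (Upper L C) \<and>
                greatest L m (Lower L {x, s}) \<and>
                (\<forall>c\<in>C. greatest L (g c) (Lower L {x, c})) \<and>
                least L m (Upper L (g ` C)))"

definition compact_element :: "('a, 'b) gorder_scheme \<Rightarrow> 'a \<Rightarrow> bool" where
  "compact_element L k \<longleftrightarrow>
     k \<in> carrier L \<and>
     (\<forall>D s. directed L D \<and> least L s (Upper L D) \<and> k \<sqsubseteq>\<^bsub>L\<^esub> s \<longrightarrow> (\<exists>d\<in>D. k \<sqsubseteq>\<^bsub>L\<^esub> d))"

definition algebraic :: "('a, 'b) gorder_scheme \<Rightarrow> bool" where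
  "algebraic L \<longleftrightarrow>
     (\<forall>x\<in>carrier L. least L x (Upper L {k. compact_element L k \<and> k \<sqsubseteq>\<^bsub>L\<^esub> x}))"

definition relatively_complemented :: "('a, 'b) gorder_scheme \<Rightarrow> bool" where
  "relatively_complemented L \<longleftrightarrow>
     (\<forall>x\<in>carrier L. \<forall>y\<in>carrier L. \<forall>z\<in>carrier L.
        x \<sqsubseteq>\<^bsub>L\<^esub> y \<and> y \<sqsubseteq>\<^bsub>L\<^esub> z \<longrightarrow>
        (\<exists>w\<in>carrier L. greatest L x (Lower L {w, y}) \<and> least L z (Upper L {w, y})))"

text \<open>
  In the next definition \<open>j\<close>, \<open>m\<close> and \<open>u\<close> are \<open>y \<squnion> z\<close>, \<open>x \<sqinter> z\<close> and the
  common value of \<open>x \<sqinter> (y \<squnion> z)\<close> and \<open>y \<squnion> (x \<sqinter> z)\<close>.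
\<close>

definition conditionally_modular :: "('a, 'b) gorder_scheme \<Rightarrow> bool" where
  "conditionally_modular L \<longleftrightarrow>
     (\<forall>x\<in>carrier L. \<forall>y\<in>carrier L. \<forall>z\<in>carrier L.
        Upper L {y, z} \<noteq> {} \<and> y \<sqsubseteq>\<^bsub>L\<^esub> x \<longrightarrow>
        (\<exists>j m u. least L j (Upper L {y, z}) \<and>
                 greatest L m (Lower L {x, z}) \<and>
                 greatest L u (Lower L {x, j}) \<and>
                 least L u (Upper L {y, m})))"

locale projective_domain = partial_order L + weak_partial_order_bottom L
  for L (structure) +
  assumes directed_complete: "directed_complete L"
    and bounded_complete: "bounded_complete L"
    and atomistic: "atomistic L"
    and meet_continuous: "meet_continuous L"
    and relatively_complemented: "relatively_complemented L"
    and conditionally_modular: "conditionally_modular L"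


section \<open>State systems\<close>

definition prep_equiv :: "'p set \<Rightarrow> 't set \<Rightarrow> ('p \<Rightarrow> 't \<Rightarrow> outcome) \<Rightarrow> 'p rel" where
  "prep_equiv P T e = {(p, q). p \<in> P \<and> q \<in> P \<and> (\<forall>t\<in>T. e p t = e q t)}"

text \<open>
  A state is a class of preparations, on which \<open>\<lambda>p. e p t\<close> is constant for every test \<open>t\<close>;
  the evaluation of the state is that constant (see \<open>state_eval_class\<close> below).
\<close>

definition state_eval :: "('p \<Rightarrow> 't \<Rightarrow> outcome) \<Rightarrow> 't \<Rightarrow> 'p set \<Rightarrow> outcome" where
  "state_eval e t \<sigma> = the_elem ((\<lambda>p. e p t) ` \<sigma>)"

definition state_poset ::
    "'p set \<Rightarrow> 't set \<Rightarrow> ('p \<Rightarrow> 't \<Rightarrow> outcome) \<Rightarrow> 'p set gorder" where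
  "state_poset P T e =
     \<lparr>carrier = P // prep_equiv P T e,
      eq = (=),
      le = (\<lambda>\<sigma> \<tau>. \<forall>t\<in>T. state_eval e t \<sigma> \<le> state_eval e t \<tau>)\<rparr>"

lemma equiv_prep_equiv: "equiv P (prep_equiv P T e)"
  by (rule equivI) (auto simp: prep_equiv_def refl_on_def sym_def trans_def)

lemma state_eval_class:
  assumes "p \<in> P" "t \<in> T"
  shows "state_eval e t (prep_equiv P T e `` {p}) = e p t"
proof -
  have "(\<lambda>q. e q t) ` (prep_equiv P T e `` {p}) = {e p t}"
    using assms by (auto simp: prep_equiv_def image_iff intro!: exI[of _ p])
  then show ?thesis
    by (simp add: state_eval_def)
qed

lemma partial_order_state_poset: "partial_order (state_poset P T e)"
proof
  show "(.=\<^bsub>state_poset P T e\<^esub>) = (=)"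
    by (simp add: state_poset_def)
next
  fix \<sigma> \<tau>
  assume le: "\<sigma> \<sqsubseteq>\<^bsub>state_poset P T e\<^esub> \<tau>" "\<tau> \<sqsubseteq>\<^bsub>state_poset P T e\<^esub> \<sigma>"
    and carr: "\<sigma> \<in> carrier (state_poset P T e)" "\<tau> \<in> carrier (state_poset P T e)"
  from carr obtain p q where pq: "p \<in> P" "q \<in> P"
      "\<sigma> = prep_equiv P T e `` {p}" "\<tau> = prep_equiv P T e `` {q}"
    by (auto simp: state_poset_def quotient_def)
  have "e p t = e q t" if t: "t \<in> T" for t
  proof (rule order.antisym)
    show "e p t \<le> e q t" "e q t \<le> e p t"
      using le t pq state_eval_class[OF pq(1) t, of e] state_eval_class[OF pq(2) t, of e]
      by (auto simp: state_poset_def dest!: bspec[OF _ t])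
  qed
  then have "(p, q) \<in> prep_equiv P T e"
    using pq by (simp add: prep_equiv_def)
  then show "\<sigma> .=\<^bsub>state_poset P T e\<^esub> \<tau>"
    using pq equiv_class_eq[OF equiv_prep_equiv] by (simp add: state_poset_def)
qed (auto simp: state_poset_def intro: order.trans)

locale state_data =
  fixes P :: "'p set" and T :: "'t set" and e :: "'p \<Rightarrow> 't \<Rightarrow> outcome" and bar :: "'t \<Rightarrow> 't"
  assumes bar_closed: "bar \<in> T \<rightarrow> T"
    and eval_bar: "\<lbrakk>p \<in> P; t \<in> T\<rbrakk> \<Longrightarrow> e p (bar t) = flip (e p t)"
begin

abbreviation S :: "'p set gorder" where
  "S \<equiv> state_poset P T e"

end

text \<open>
  Since \<^typ>\<open>outcome\<close> is finite, \<^const>\<open>Inf_fin\<close> is the infimum of an arbitrary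
  nonempty set of outcomes.
\<close>

locale state_system = state_data +
  assumes A1: "\<lbrakk>Q \<subseteq> P; Q \<noteq> {}\<rbrakk> \<Longrightarrow>
        \<exists>!q. q \<in> P \<and> (\<forall>t\<in>T. e q t = \<Sqinter>\<^sub>f\<^sub>i\<^sub>n ((\<lambda>p. e p t) ` Q))"
    and A2: "\<exists>!q. q \<in> P \<and> (\<forall>t\<in>T. e q t = Bot)"
    and A3: "C \<in> chains S \<Longrightarrow> \<exists>s. least S s (Upper S C)"
    and A4: "\<lbrakk>t \<in> T; C \<in> chains S; least S s (Upper S C); state_eval e t s = Yes\<rbrakk> \<Longrightarrow>
        \<exists>\<sigma>\<in>C. state_eval e t \<sigma> = Yes"
    and A5: "\<lbrakk>\<sigma> \<in> carrier S; \<sigma>' \<in> carrier S; \<sigma> \<sqsubset>\<^bsub>S\<^esub> \<sigma>'\<rbrakk> \<Longrightarrow>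
        \<exists>\<sigma>''\<in>carrier S. \<sigma> \<lessdot>\<^bsub>S\<^esub> \<sigma>'' \<and> \<sigma>'' \<sqsubseteq>\<^bsub>S\<^esub> \<sigma>'"
    and A6a: "relatively_complemented S"
    and A6b: "\<lbrakk>\<sigma>\<^sub>1' \<in> carrier S; \<sigma>\<^sub>2 \<in> carrier S; \<sigma>\<^sub>2' \<in> carrier S;
         \<sigma>\<^sub>1' \<sqsubseteq>\<^bsub>S\<^esub> \<sigma>\<^sub>2'; \<sigma>\<^sub>2 \<lessdot>\<^bsub>S\<^esub> \<sigma>\<^sub>2'; \<not> \<sigma>\<^sub>1' \<sqsubseteq>\<^bsub>S\<^esub> \<sigma>\<^sub>2\<rbrakk> \<Longrightarrow>
        \<exists>m. greatest S m (Lower S {\<sigma>\<^sub>1', \<sigma>\<^sub>2}) \<and> m \<lessdot>\<^bsub>S\<^esub> \<sigma>\<^sub>1'"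
    and A6c: "\<lbrakk>\<sigma>\<^sub>1 \<in> carrier S; \<sigma>\<^sub>1' \<in> carrier S; \<sigma>\<^sub>2 \<in> carrier S; \<sigma>\<^sub>2' \<in> carrier S;
         \<sigma>\<^sub>1 \<sqsubseteq>\<^bsub>S\<^esub> \<sigma>\<^sub>1'; \<sigma>\<^sub>1' \<sqsubseteq>\<^bsub>S\<^esub> \<sigma>\<^sub>2'; \<sigma>\<^sub>1 \<lessdot>\<^bsub>S\<^esub> \<sigma>\<^sub>2; \<sigma>\<^sub>2 \<sqsubseteq>\<^bsub>S\<^esub> \<sigma>\<^sub>2'; \<not> \<sigma>\<^sub>2 \<sqsubseteq>\<^bsub>S\<^esub> \<sigma>\<^sub>1'\<rbrakk> \<Longrightarrow>
        \<exists>j. least S j (Upper S {\<sigma>\<^sub>1', \<sigma>\<^sub>2}) \<and> \<sigma>\<^sub>1' \<lessdot>\<^bsub>S\<^esub> j"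

end

theory Submission
  imports Defs
begin

text \<open>
  Evaluation of states preserves nonempty infima, and by (A4), applied to a test and to its
  conjugate, also suprema of chains. Hence the states are bounded complete and
  meet-continuous, and everything else is order theory.

  \<^item> A lower set that is closed under suprema of chains contains an upper bound of each directed
  subset \<open>D\<close>: by Zorn's lemma there is a maximal element among those that are bounded, within the
  lower set, together with every \<open>d \<in> D\<close>, and it dominates \<open>D\<close>. This gives directed
  completeness, and compactness of an atom \<open>a\<close> from the lower set \<open>{x. \<not> a \<sqsubseteq> x}\<close>.

  \<^item> Conditional modularity holds for \<open>y \<sqsubseteq> x\<close> and \<open>z\<close> below a cover of \<open>x\<close>, by the two covering
  properties (A6)(b), (c). In general, \<open>x \<sqinter> (y \<squnion> (w \<sqinter> z)) \<sqsubseteq> y \<squnion> (x \<sqinter> z)\<close> is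
  inherited by covers of \<open>w\<close> and by suprema of chains, so by Zorn's lemma it climbs from \<open>w = x\<close> to
  \<open>w = y \<squnion> z\<close>.
\<close>

section \<open>Suprema, chains, covers and Zorn's lemma for orders on a carrier\<close>

lemma least_UpperD:
  assumes "least L s (Upper L A)"
  shows "s \<in> carrier L" "a \<in> A \<Longrightarrow> a \<in> carrier L \<Longrightarrow> a \<sqsubseteq>\<^bsub>L\<^esub> s"
    "u \<in> carrier L \<Longrightarrow> (\<And>a. a \<in> A \<Longrightarrow> a \<sqsubseteq>\<^bsub>L\<^esub> u) \<Longrightarrow> s \<sqsubseteq>\<^bsub>L\<^esub> u"
  using assms by (auto simp: least_def Upper_def)

lemma chainsD:
  assumes "C \<in> chains L"
  shows "C \<subseteq> carrier L" "C \<noteq> {}" "x \<in> C \<Longrightarrow> y \<in> C \<Longrightarrow> x \<sqsubseteq>\<^bsub>L\<^esub> y \<or> y \<sqsubseteq>\<^bsub>L\<^esub> x"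
  using assms by (auto simp: chains_def Complete_Partial_Order.chain_def)

lemma chains_image:
  assumes "C \<in> chains L" "\<And>x. x \<in> C \<Longrightarrow> f x \<in> carrier L"
    and "\<And>x y. x \<in> C \<Longrightarrow> y \<in> C \<Longrightarrow> x \<sqsubseteq>\<^bsub>L\<^esub> y \<Longrightarrow> f x \<sqsubseteq>\<^bsub>L\<^esub> f y"
  shows "f ` C \<in> chains L"
proof -
  have "f x \<sqsubseteq>\<^bsub>L\<^esub> f y \<or> f y \<sqsubseteq>\<^bsub>L\<^esub> f x" if "x \<in> C" "y \<in> C" for x y
    using assms(3) chainsD(3)[OF assms(1) that] that by blast
  then show ?thesis
    using assms(2) chainsD(2)[OF assms(1)]
    by (auto simp: chains_def Complete_Partial_Order.chain_def)
qed

lemma coversD: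
  assumes "x \<lessdot>\<^bsub>L\<^esub> y"
  shows "x \<in> carrier L" "y \<in> carrier L" "x \<sqsubseteq>\<^bsub>L\<^esub> y"
  using assms by (auto simp: covers_def lless_def)

context partial_order
begin

lemma not_covers_self: "\<not> x \<lessdot> x"
  by (auto simp: covers_def lless_eq)

lemma covers_between:
  assumes "x \<lessdot> y" "z \<in> carrier L" "x \<sqsubseteq> z" "z \<sqsubseteq> y"
  shows "z = x \<or> z = y"
  using assms by (auto simp: covers_def lless_eq)

text \<open>Zorn's lemma for a subset of the carrier. Members of \<open>chains\<close> are nonempty,
  so the witness \<open>k\<close> serves as the bound of the empty chain.\<close>

lemma exists_maximal:
  assumes K: "K \<subseteq> carrier L" and k: "k \<in> K"
    and ch: "\<And>C. C \<in> chains L \<Longrightarrow> C \<subseteq> K \<Longrightarrow> \<exists>u\<in>K. \<forall>c\<in>C. c \<sqsubseteq> u"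
  obtains m where "m \<in> K" "\<And>x. x \<in> K \<Longrightarrow> m \<sqsubseteq> x \<Longrightarrow> x = m"
proof -
  have "\<exists>m\<in>K. \<forall>x\<in>K. m \<sqsubseteq> x \<longrightarrow> x = m"
  proof (rule predicate_Zorn)
    show "partial_order_on K (relation_of (\<sqsubseteq>) K)"
      using K by (intro partial_order_on_relation_ofI) (auto intro: le_trans dest: subsetD)
    show "\<exists>u\<in>K. \<forall>c\<in>C. c \<sqsubseteq> u" if "C \<in> Chains (relation_of (\<sqsubseteq>) K)" for C
    proof (cases "C = {}")
      case True
      then show ?thesis using k by blast
    next
      case False
      have "C \<subseteq> K"
        using that by (auto simp: Chains_def relation_of_def)
      moreover from this have "C \<in> chains L"
        using that False K
        by (auto simp: Chains_def relation_of_def chains_def Complete_Partial_Order.chain_def)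
      ultimately show ?thesis by (rule ch[rotated])
    qed
  qed
  then show thesis using that by blast
qed

end


section \<open>Meet-continuous bounded complete semilattices\<close>

text \<open>Chain completeness is contained in \<open>meet_continuous\<close>, which asserts that
  the suprema in its equation exist; \<open>chain_lub\<close> extracts it by taking x to be the
  bottom.\<close>

locale meet_continuous_semilattice =
  lower_semilattice L + weak_partial_order_bottom L for L (structure) +
  assumes bounded_complete: "bounded_complete L"
    and meet_continuous: "meet_continuous L"
begin

lemma le_bottom: "x \<in> carrier L \<Longrightarrow> x \<sqsubseteq> \<bottom> \<Longrightarrow> x = \<bottom>"
  by (intro le_antisym) auto

lemma chain_lub:
  assumes "C \<in> chains L"
  obtains s where "least L s (Upper L C)"
  using that bspec[OF bspec[OF meet_continuous[unfolded meet_continuous_def] bottom_closed] assms]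
  by (elim exE conjE)

text \<open>\<open>meet_continuous\<close> provides its own supremum and meets. Uniqueness
  identifies them with the given \<open>s\<close> and with the operation \<sqinter>.\<close>

lemma meet_least:
  assumes "x \<in> carrier L" "C \<in> chains L" "least L s (Upper L C)"
  shows "least L (x \<sqinter> s) (Upper L ((\<sqinter>) x ` C))"
proof -
  obtain s' m g where s': "least L s' (Upper L C)" and m: "greatest L m (Lower L {x, s'})"
    and g: "\<forall>c\<in>C. greatest L (g c) (Lower L {x, c})"
    and least: "least L m (Upper L (g ` C))"
    using bspec[OF bspec[OF meet_continuous[unfolded meet_continuous_def] assms(1)] assms(2)]
    by (elim exE conjE)
  have glb: "y = x \<sqinter> c" if "greatest L y (Lower L {x, c})" "c \<in> carrier L" for y c
    using inf_of_two_greatest[OF assms(1) that(2)] greatest_unique that(1)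
    unfolding meet_def by blast
  have "s' = s"
    using s' assms(3) by (rule least_unique)
  then have "m = x \<sqinter> s"
    using glb m least_UpperD(1)[OF assms(3)] by blast
  moreover have "g ` C = (\<sqinter>) x ` C"
    using glb g chainsD(1)[OF assms(2)] by (intro image_cong) auto
  ultimately show ?thesis using least by simp
qed

lemma bounded_lub:
  assumes "A \<subseteq> carrier L" "u \<in> carrier L" "\<And>a. a \<in> A \<Longrightarrow> a \<sqsubseteq> u"
  obtains s where "least L s (Upper L A)"
proof -
  have "u \<in> Upper L A"
    using assms by (simp add: Upper_def)
  then have "Upper L A \<noteq> {}" by (metis empty_iff)
  then show thesis
    using that bounded_complete assms(1) unfolding bounded_complete_def by metis
qed

text \<open>The library's join is a Hilbert choice. A common upper bound makes the supremum exist,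
  so that the choice is the true supremum; this is why the facts about joins below carry a bound
  \<open>u\<close>.\<close>

lemma least_join:
  assumes "x \<in> carrier L" "y \<in> carrier L" "u \<in> carrier L" "x \<sqsubseteq> u" "y \<sqsubseteq> u"
  shows "least L (x \<squnion> y) (Upper L {x, y})"
proof -
  have "\<exists>s. least L s (Upper L {x, y})"
    using bounded_lub[of "{x, y}" u] assms by (metis empty_subsetI insertE insert_subset singletonD)
  then show ?thesis
    unfolding join_def sup_def by (rule someI_ex)
qed

lemma
  assumes "x \<in> carrier L" "y \<in> carrier L" "u \<in> carrier L" "x \<sqsubseteq> u" "y \<sqsubseteq> u"
  shows bounded_join_closed: "x \<squnion> y \<in> carrier L"
    and bounded_join_left: "x \<sqsubseteq> x \<squnion> y"
    and bounded_join_right: "y \<sqsubseteq> x \<squnion> y"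
    and bounded_join_le: "x \<squnion> y \<sqsubseteq> u"
  using least_UpperD[OF least_join[OF assms]] assms by auto

text \<open>Suprema commute with suprema. Together with \<open>meet_least\<close> it makes maps
  built from meets and bounded joins continuous along chains.\<close>

lemma join_chain_least:
  assumes y: "y \<in> carrier L" and C: "C \<in> chains L" "least L s (Upper L C)"
    and u: "u \<in> carrier L" "y \<sqsubseteq> u" "s \<sqsubseteq> u"
  shows "(\<squnion>) y ` C \<in> chains L" "least L (y \<squnion> s) (Upper L ((\<squnion>) y ` C))"
proof -
  note s = least_UpperD[OF C(2)]
  have c: "c \<in> carrier L" "c \<sqsubseteq> s" if "c \<in> C" for c
    using subsetD[OF chainsD(1)[OF C(1)] that] s(2)[OF that] by simp_all
  have cu: "c \<sqsubseteq> u" if "c \<in> C" for c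
    using le_trans[OF c(2)[OF that] u(3)] c(1)[OF that] s(1) u(1) by simp
  note j = bounded_join_closed[OF y c(1) u(1,2) cu] bounded_join_left[OF y c(1) u(1,2) cu]
    bounded_join_right[OF y c(1) u(1,2) cu]
  note js = bounded_join_closed[OF y s(1) u] bounded_join_left[OF y s(1) u]
    bounded_join_right[OF y s(1) u]
  note jle = bounded_join_le[OF y]
  show "(\<squnion>) y ` C \<in> chains L"
  proof (rule chains_image[OF C(1) j(1)])
    fix c' d assume cd: "c' \<in> C" "d \<in> C" "c' \<sqsubseteq> d"
    have "c' \<sqsubseteq> y \<squnion> d"
      using le_trans[OF cd(3) j(3)[OF cd(2)]] c(1) j(1) cd(1,2) by simp
    then show "y \<squnion> c' \<sqsubseteq> y \<squnion> d"
      using jle[OF c(1)[OF cd(1)] j(1)[OF cd(2)] j(2)[OF cd(2)]] cd(2) by simp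
  qed auto
  show "least L (y \<squnion> s) (Upper L ((\<squnion>) y ` C))"
  proof (rule least_UpperI)
    have up: "y \<squnion> c \<sqsubseteq> y \<squnion> s" if "c \<in> C" for c
      using jle[OF c(1)[OF that] js(1,2)] le_trans[OF c(2)[OF that] js(3)] c(1)[OF that] s(1)
        js(1) by simp
    show "z \<sqsubseteq> y \<squnion> s" if "z \<in> (\<squnion>) y ` C" for z
      using that up by auto
    show "y \<squnion> s \<sqsubseteq> v" if v: "v \<in> Upper L ((\<squnion>) y ` C)" for v
    proof -
      have vc: "v \<in> carrier L" using v by (simp add: Upper_def)
      have jv: "y \<squnion> c \<sqsubseteq> v" if "c \<in> C" for c
        using v that j(1)[OF that that] by (simp add: Upper_def)
      \<comment> \<open>A member of the chain is what brings \<open>y\<close> itself below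
        \<open>v\<close>.\<close>
      obtain c0 where "c0 \<in> C" using chainsD(2)[OF C(1)] by blast
      then have "y \<sqsubseteq> v"
        using le_trans[OF j(2) jv] y j(1) vc by simp
      moreover have "c \<sqsubseteq> v" if "c \<in> C" for c
        using le_trans[OF j(3)[OF that] jv[OF that]] c(1)[OF that] j(1)[OF that] vc that by simp
      then have "s \<sqsubseteq> v" by (rule s(3)[OF vc])
      ultimately show ?thesis
        using jle[OF s(1) vc] by simp
    qed
  qed (use j(1) js(1) in \<open>simp_all add: image_subset_iff\<close>)
qed

lemma lower_set_directed_bound:
  assumes D: "directed L D" and G: "D \<subseteq> G" "G \<subseteq> carrier L"
    and lower: "\<And>x y. y \<in> G \<Longrightarrow> x \<in> carrier L \<Longrightarrow> x \<sqsubseteq> y \<Longrightarrow> x \<in> G"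
    and chain_closed: "\<And>C s. C \<in> chains L \<Longrightarrow> C \<subseteq> G \<Longrightarrow> least L s (Upper L C) \<Longrightarrow> s \<in> G"
  shows "\<exists>u\<in>G. \<forall>d\<in>D. d \<sqsubseteq> u"
proof -
  have Dc: "D \<subseteq> carrier L" and "D \<noteq> {}"
    and up: "\<And>c d. c \<in> D \<Longrightarrow> d \<in> D \<Longrightarrow> \<exists>z\<in>D. c \<sqsubseteq> z \<and> d \<sqsubseteq> z"
    using D by (auto simp: directed_def)
  \<comment> \<open>The bound \<open>u\<close> may depend on \<open>d\<close>; a bound for all of
    \<open>D\<close> at once is the goal.\<close>
  define K where "K = {x \<in> carrier L. \<forall>d\<in>D. \<exists>u\<in>G. x \<sqsubseteq> u \<and> d \<sqsubseteq> u}"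
  have "\<exists>u\<in>G. \<bottom> \<sqsubseteq> u \<and> d \<sqsubseteq> u" if "d \<in> D" for d
    using that G(1) Dc by (intro bexI[of _ d]) auto
  then have "\<bottom> \<in> K"
    by (simp add: K_def)
  moreover have "\<exists>u\<in>K. \<forall>c\<in>C. c \<sqsubseteq> u" if C: "C \<in> chains L" "C \<subseteq> K" for C
  proof -
    obtain s where s: "least L s (Upper L C)"
      using chain_lub[OF C(1)] .
    note sD = least_UpperD[OF s]
    have cC: "c \<in> carrier L" "c \<sqsubseteq> s" if "c \<in> C" for c
      using subsetD[OF chainsD(1)[OF C(1)] that] sD(2)[OF that] by simp_all
    \<comment> \<open>For fixed \<open>d\<close> the joins of \<open>d\<close> with the members of
      \<open>C\<close> form a chain. It lies in \<open>G\<close> because each join is below an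
      element of \<open>G\<close>. Its supremum \<open>r\<close> is in \<open>G\<close> and
      dominates both \<open>d\<close> and \<open>s\<close>.\<close>
    have "\<exists>u\<in>G. s \<sqsubseteq> u \<and> d \<sqsubseteq> u" if d: "d \<in> D" for d
    proof -
      have dc: "d \<in> carrier L" using d Dc by blast
      have J: "d \<squnion> c \<in> G" "d \<sqsubseteq> d \<squnion> c" "c \<sqsubseteq> d \<squnion> c" "d \<squnion> c \<in> carrier L"
        and Jle: "\<And>v. v \<in> carrier L \<Longrightarrow> d \<sqsubseteq> v \<Longrightarrow> c \<sqsubseteq> v \<Longrightarrow> d \<squnion> c \<sqsubseteq> v"
        if c: "c \<in> C" for c
      proof -
        obtain u where u: "u \<in> G" "c \<sqsubseteq> u" "d \<sqsubseteq> u"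
          using c C(2) d unfolding K_def by blast
        then have uc: "u \<in> carrier L" using G by blast
        note b = dc cC(1)[OF c] uc u(3,2)
        show "d \<sqsubseteq> d \<squnion> c" "c \<sqsubseteq> d \<squnion> c" "d \<squnion> c \<in> carrier L"
          using bounded_join_left[OF b] bounded_join_right[OF b] bounded_join_closed[OF b] .
        show "d \<squnion> c \<in> G"
          using lower[OF u(1)] bounded_join_le[OF b] bounded_join_closed[OF b] by blast
        show "d \<squnion> c \<sqsubseteq> v" if "v \<in> carrier L" "d \<sqsubseteq> v" "c \<sqsubseteq> v" for v
          using bounded_join_le[OF dc cC(1)[OF c] that] .
      qed
      have "(\<squnion>) d ` C \<in> chains L"
      proof (rule chains_image[OF C(1) J(4)])
        fix c c' assume cc': "c \<in> C" "c' \<in> C" "c \<sqsubseteq> c'"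
        have "c \<sqsubseteq> d \<squnion> c'"
          using le_trans[OF cc'(3) J(3)[OF cc'(2)]] cC(1) J(4) cc'(1,2) by simp
        then show "d \<squnion> c \<sqsubseteq> d \<squnion> c'"
          using Jle[OF cc'(1) J(4)[OF cc'(2)] J(2)[OF cc'(2)]] by simp
      qed auto
      moreover from this obtain r where r: "least L r (Upper L ((\<squnion>) d ` C))"
        using chain_lub by blast
      ultimately have rG: "r \<in> G"
        using chain_closed J(1) by blast
      note rD = least_UpperD[OF r]
      have jr: "d \<squnion> c \<sqsubseteq> r" if "c \<in> C" for c
        using rD(2)[OF imageI[OF that]] J(4)[OF that] by simp
      obtain c0 where "c0 \<in> C" using chainsD(2)[OF C(1)] by blast
      then have "d \<sqsubseteq> r"
        using le_trans[OF J(2) jr] dc J(4) rD(1) by simp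
      moreover have "c \<sqsubseteq> r" if "c \<in> C" for c
        using le_trans[OF J(3)[OF that] jr[OF that]] cC(1)[OF that] J(4)[OF that] rD(1) by simp
      then have "s \<sqsubseteq> r" by (rule sD(3)[OF rD(1)])
      ultimately show ?thesis using rG by blast
    qed
    then have "s \<in> K" using sD(1) by (simp add: K_def)
    then show ?thesis using cC by blast
  qed
  moreover have "K \<subseteq> carrier L" by (auto simp: K_def)
  ultimately obtain m where m: "m \<in> K" and max: "\<And>x. x \<in> K \<Longrightarrow> m \<sqsubseteq> x \<Longrightarrow> x = m"
    using exists_maximal[of K \<bottom>] by blast
  have mc: "m \<in> carrier L" using m by (simp add: K_def)
  have "d \<sqsubseteq> m" if d: "d \<in> D" for d
  proof -
    have dc: "d \<in> carrier L" using d Dc by blast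
    obtain u where u: "u \<in> G" "m \<sqsubseteq> u" "d \<sqsubseteq> u"
      using m d unfolding K_def by blast
    then have uc: "u \<in> carrier L" using G by blast
    note b = mc dc uc u(2,3)
    \<comment> \<open>Directedness enters here: a bound in \<open>G\<close> of \<open>m\<close> and
      of some \<open>z\<close> in \<open>D\<close> above \<open>d\<close> and \<open>d'\<close> also
      bounds \<open>m \<squnion> d\<close> and \<open>d'\<close>. Hence
      \<open>m \<squnion> d\<close> is in \<open>K\<close>, and maximality gives
      \<open>d \<sqsubseteq> m\<close>.\<close>
    have "\<exists>v\<in>G. m \<squnion> d \<sqsubseteq> v \<and> d' \<sqsubseteq> v" if d': "d' \<in> D" for d'
    proof -
      obtain z where z: "z \<in> D" "d \<sqsubseteq> z" "d' \<sqsubseteq> z"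
        using up d d' by blast
      obtain v where v: "v \<in> G" "m \<sqsubseteq> v" "z \<sqsubseteq> v"
        using m z unfolding K_def by blast
      have c: "z \<in> carrier L" "v \<in> carrier L" "d' \<in> carrier L"
        using z v d' Dc G by auto
      have "d \<sqsubseteq> v" "d' \<sqsubseteq> v"
        using le_trans[OF z(2) v(3)] le_trans[OF z(3) v(3)] c dc by simp_all
      then show ?thesis
        using bounded_join_le[OF mc dc c(2) v(2)] v(1) by blast
    qed
    then have "m \<squnion> d \<in> K"
      using bounded_join_closed[OF b] by (simp add: K_def)
    then have "m \<squnion> d = m"
      using max bounded_join_left[OF b] by blast
    then show ?thesis using bounded_join_right[OF b] by simp
  qed
  moreover obtain d where d: "d \<in> D" using \<open>D \<noteq> {}\<close> by blast
  moreover obtain u where "u \<in> G" "m \<sqsubseteq> u"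
    using m d unfolding K_def by blast
  then have "m \<in> G" using lower mc by simp
  ultimately show ?thesis by blast
qed

text \<open>With the whole carrier as lower set, \<open>lower_set_directed_bound\<close> yields an
  upper bound, and bounded completeness then yields the supremum.\<close>

lemma directed_complete: "directed_complete L"
proof -
  have "\<exists>s. least L s (Upper L D)" if D: "directed L D" for D
  proof -
    have Dc: "D \<subseteq> carrier L" using D by (simp add: directed_def)
    obtain u where "u \<in> carrier L" "\<forall>d\<in>D. d \<sqsubseteq> u"
      using lower_set_directed_bound[OF D Dc order.refl] least_UpperD(1) by metis
    then show ?thesis
      using bounded_lub[OF Dc] by metis
  qed
  then show ?thesis by (simp add: directed_complete_def)
qed

text \<open>The meet lies between \<bottom> and the atom, hence is one of the two. Failing to be
  above \<open>a\<close> thus becomes an equation between meets, which meet-continuity carries to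
  suprema of chains.\<close>

lemma atom_below_iff:
  assumes "atom L a" "x \<in> carrier L"
  shows "a \<sqsubseteq> x \<longleftrightarrow> a \<sqinter> x \<noteq> \<bottom>"
proof -
  have a: "\<bottom> \<lessdot> a" "a \<in> carrier L" "a \<noteq> \<bottom>"
    using assms(1) not_covers_self coversD(2) by (auto simp: atom_def)
  have "a \<sqinter> x = \<bottom> \<or> a \<sqinter> x = a"
    using covers_between[OF a(1)] meet_left meet_closed a assms(2) by simp
  moreover have "a \<sqinter> x = a" if "a \<sqsubseteq> x"
    using that meet_le[of a a x] meet_left a assms(2) by (intro le_antisym) auto
  ultimately show ?thesis
    using meet_right[OF a(2) assms(2)] a(3) by auto
qed

lemma atom_compact:
  assumes "atom L a"
  shows "compact_element L a"
proof -
  have ac: "a \<in> carrier L"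
    using assms coversD(2) by (auto simp: atom_def)
  have "\<exists>d\<in>D. a \<sqsubseteq> d" if D: "directed L D" "least L s (Upper L D)" "a \<sqsubseteq> s" for D s
  proof (rule ccontr)
    assume none: "\<not> (\<exists>d\<in>D. a \<sqsubseteq> d)"
    have Dc: "D \<subseteq> carrier L" using D by (simp add: directed_def)
    let ?G = "{x \<in> carrier L. \<not> a \<sqsubseteq> x}"
    have "\<exists>u\<in>?G. \<forall>d\<in>D. d \<sqsubseteq> u"
    proof (rule lower_set_directed_bound[OF D(1)])
      show "D \<subseteq> ?G" using Dc none by blast
      show "x \<in> ?G" if "y \<in> ?G" "x \<in> carrier L" "x \<sqsubseteq> y" for x y
        using that ac le_trans[of a x y] by blast
      \<comment> \<open>All meets of \<open>a\<close> with members of \<open>C\<close> are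
        \<bottom>, so their supremum \<open>a \<sqinter> r\<close> is \<bottom> too.\<close>
      show "r \<in> ?G" if C: "C \<in> chains L" "C \<subseteq> ?G" "least L r (Upper L C)" for C r
      proof -
        note rD = least_UpperD[OF C(3)]
        have "a \<sqinter> c = \<bottom>" if "c \<in> C" for c
          using that C(2) atom_below_iff[OF assms] by blast
        then have "a \<sqinter> r \<sqsubseteq> \<bottom>"
          using least_UpperD(3)[OF meet_least[OF ac C(1,3)] bottom_closed] by auto
        then have "a \<sqinter> r = \<bottom>"
          using le_bottom rD(1) ac meet_closed by simp
        then show ?thesis using atom_below_iff[OF assms] rD(1) by blast
      qed
    qed auto
    then obtain u where u: "u \<in> carrier L" "\<not> a \<sqsubseteq> u" "\<forall>d\<in>D. d \<sqsubseteq> u" by blast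
    have "s \<sqsubseteq> u" using u(3) by (intro least_UpperD(3)[OF D(2) u(1)]) simp
    then show False
      using le_trans[OF D(3)] u(1,2) ac least_UpperD(1)[OF D(2)] by simp
  qed
  then show ?thesis using ac by (auto simp: compact_element_def)
qed

text \<open>Atoms are compact, so an upper bound of the compact elements below \<open>x\<close>
  bounds the atoms below \<open>x\<close>, whose supremum is \<open>x\<close>.\<close>

lemma algebraic_if_atomistic:
  assumes "atomistic L"
  shows "algebraic L"
  unfolding algebraic_def
proof
  fix x assume x: "x \<in> carrier L"
  let ?A = "{a \<in> carrier L. atom L a \<and> a \<sqsubseteq> x}"
  let ?K = "{k. compact_element L k \<and> k \<sqsubseteq> x}"
  have A: "least L x (Upper L ?A)"
    using assms x by (simp add: atomistic_def)
  show "least L x (Upper L ?K)"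
  proof (rule least_UpperI)
    show "x \<sqsubseteq> u" if u: "u \<in> Upper L ?K" for u
    proof (rule least_UpperD(3)[OF A])
      show "u \<in> carrier L" using u by (simp add: Upper_def)
      show "a \<sqsubseteq> u" if "a \<in> ?A" for a
        using that u atom_compact by (auto simp: Upper_def)
    qed
  qed (use x in \<open>auto simp: compact_element_def\<close>)
qed

text \<open>Let \<open>y\<close> be the supremum of the atoms below \<open>x\<close>, and
  \<open>w\<close> a complement of \<open>y\<close> in the interval from \<bottom> to
  \<open>x\<close>. If \<open>w\<close> were not \<bottom>, there would be an atom below
  \<open>w\<close>; being below \<open>x\<close>, it would also be below \<open>y\<close>,
  contradicting that the meet of \<open>w\<close> and \<open>y\<close> is \<bottom>. So
  \<open>w\<close> is \<bottom> and \<open>x = y\<close>.\<close>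

lemma atomistic:
  assumes weakly_atomic: "\<And>x y. x \<in> carrier L \<Longrightarrow> y \<in> carrier L \<Longrightarrow> x \<sqsubset> y \<Longrightarrow>
      \<exists>z\<in>carrier L. x \<lessdot> z \<and> z \<sqsubseteq> y"
    and rc: "relatively_complemented L"
  shows "atomistic L"
  unfolding atomistic_def
proof
  fix x assume x: "x \<in> carrier L"
  let ?A = "{a \<in> carrier L. atom L a \<and> a \<sqsubseteq> x}"
  obtain y where y: "least L y (Upper L ?A)"
    by (rule bounded_lub[of ?A x]) (use x in simp_all)
  note yD = least_UpperD[OF y]
  have "y \<sqsubseteq> x" using yD(3)[OF x] by simp
  then obtain w where w: "w \<in> carrier L" "greatest L \<bottom> (Lower L {w, y})"
      "least L x (Upper L {w, y})"
    using rc bottom_closed bottom_lower yD(1) x unfolding relatively_complemented_def by blast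
  note wD = least_UpperD[OF w(3)]
  have "w = \<bottom>"
  proof (rule ccontr)
    assume "w \<noteq> \<bottom>"
    then have "\<bottom> \<sqsubset> w" using w(1) by (auto simp: lless_eq)
    then obtain a where a: "a \<in> carrier L" "\<bottom> \<lessdot> a" "a \<sqsubseteq> w"
      using weakly_atomic w(1) by blast
    have "a \<sqsubseteq> x" using le_trans[OF a(3) wD(2)] a(1) w(1) x by simp
    then have "a \<sqsubseteq> y" using yD(2) a by (auto simp: atom_def)
    then have "a \<in> Lower L {w, y}" using a by (auto intro: Lower_memI)
    then have "a \<sqsubseteq> \<bottom>" using w(2) by (auto simp: greatest_def)
    then have "a = \<bottom>" using a(1) le_bottom by simp
    then show False using a(2) not_covers_self by blast
  qed
  then have "x \<sqsubseteq> y" using wD(3)[OF yD(1)] yD(1) by auto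
  then have "x = y" using \<open>y \<sqsubseteq> x\<close> x yD(1) by (intro le_antisym)
  then show "least L x (Upper L ?A)" using y by simp
qed

end


section \<open>Conditional modularity\<close>

text \<open>(A5) and (A6)(b), (c), phrased with the operations \<sqinter> and \<squnion> in place of
  existential witnesses.\<close>

locale covering_semilattice = meet_continuous_semilattice +
  assumes weakly_atomic: "\<lbrakk>x \<in> carrier L; y \<in> carrier L; x \<sqsubset> y\<rbrakk> \<Longrightarrow>
        \<exists>z\<in>carrier L. x \<lessdot> z \<and> z \<sqsubseteq> y"
    and meet_covered: "\<lbrakk>x \<in> carrier L; x \<sqsubseteq> w; y \<lessdot> w; \<not> x \<sqsubseteq> y\<rbrakk> \<Longrightarrow> x \<sqinter> y \<lessdot> x"
    and covered_join: "\<lbrakk>y \<in> carrier L; u \<in> carrier L; x \<sqsubseteq> y; y \<sqsubseteq> u; x \<lessdot> z; z \<sqsubseteq> u; \<not> z \<sqsubseteq> y\<rbrakk> \<Longrightarrow>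
        y \<lessdot> y \<squnion> z"
begin

text \<open>If \<open>z\<close> is not below \<open>x\<close>, then \<open>x \<sqinter> z\<close> is
  covered by \<open>z\<close>, and joining with \<open>a = y \<squnion> (x \<sqinter> z)\<close>
  shows that \<open>a\<close> is covered by \<open>y \<squnion> z\<close>. The element
  \<open>x \<sqinter> (y \<squnion> z)\<close> lies between these two and differs from the upper
  one, since \<open>z\<close> is not below \<open>x\<close>; so it equals \<open>a\<close>.\<close>

lemma modular_below_cover:
  assumes xw: "x \<lessdot> w" and y: "y \<in> carrier L" "y \<sqsubseteq> x" and z: "z \<in> carrier L" "z \<sqsubseteq> w"
  shows "x \<sqinter> (y \<squnion> z) \<sqsubseteq> y \<squnion> (x \<sqinter> z)"
proof -
  have c: "x \<in> carrier L" "w \<in> carrier L" "x \<sqsubseteq> w"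
    using coversD[OF xw] by auto
  have yw: "y \<sqsubseteq> w" using le_trans[OF y(2) c(3)] y(1) c by simp
  note j = y(1) z(1) c(2) yw z(2)
  note J = bounded_join_closed[OF j] bounded_join_left[OF j] bounded_join_right[OF j]
    bounded_join_le[OF j]
  let ?m = "x \<sqinter> z"
  have m: "?m \<in> carrier L" "?m \<sqsubseteq> x" "?m \<sqsubseteq> z"
    using c z meet_left meet_right meet_closed by auto
  let ?a = "y \<squnion> ?m"
  note k = y(1) m(1) c(1) y(2) m(2)
  note A = bounded_join_closed[OF k] bounded_join_left[OF k] bounded_join_right[OF k]
    bounded_join_le[OF k]
  have M: "x \<sqinter> (y \<squnion> z) \<in> carrier L" "x \<sqinter> (y \<squnion> z) \<sqsubseteq> x" "x \<sqinter> (y \<squnion> z) \<sqsubseteq> y \<squnion> z"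
    using c J meet_left meet_right meet_closed by auto
  show ?thesis
  proof (cases "z \<sqsubseteq> x")
    case True
    then have "z \<sqsubseteq> ?m" using meet_le[of z x z] c z by auto
    then have "z \<sqsubseteq> ?a" using le_trans[OF _ A(3)] z m(1) A(1) by simp
    then have "y \<squnion> z \<sqsubseteq> ?a"
      using bounded_join_le[OF y(1) z(1) A(1,2)] by blast
    then show ?thesis using le_trans[OF M(3)] M(1) J(1) A(1) by simp
  next
    case False
    have "z \<sqinter> x \<lessdot> z" using meet_covered[OF z xw False] .
    then have mz: "?m \<lessdot> z" using meet_comm by metis
    have ma: "?m \<sqsubseteq> y \<squnion> z" using le_trans[OF m(3) J(3)] m(1) z(1) J(1) by simp
    have "?a \<sqsubseteq> y \<squnion> z"
      using bounded_join_le[OF y(1) m(1) J(1,2) ma] .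
    moreover have "\<not> z \<sqsubseteq> ?a"
      using False le_trans[OF _ A(4)] z(1) A(1) c(1) by blast
    ultimately have "?a \<lessdot> ?a \<squnion> z"
      using covered_join[OF A(1) J(1) A(3) _ mz J(3)] by blast
    moreover have "?a \<squnion> z = y \<squnion> z"
    proof (rule le_antisym)
      note b = A(1) z(1) J(1) \<open>?a \<sqsubseteq> y \<squnion> z\<close> J(3)
      note B = bounded_join_closed[OF b] bounded_join_left[OF b] bounded_join_right[OF b]
      show "?a \<squnion> z \<sqsubseteq> y \<squnion> z" using bounded_join_le[OF b] .
      have "y \<sqsubseteq> ?a \<squnion> z" using le_trans[OF A(2) B(2)] y(1) A(1) B(1) by simp
      then show "y \<squnion> z \<sqsubseteq> ?a \<squnion> z" using bounded_join_le[OF y(1) z(1) B(1) _ B(3)] by blast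
      show "?a \<squnion> z \<in> carrier L" using B(1) .
    qed (rule J(1))
    ultimately have cov: "?a \<lessdot> y \<squnion> z" by simp
    have "?a \<sqsubseteq> x \<sqinter> (y \<squnion> z)"
      using meet_le[OF A(4) \<open>?a \<sqsubseteq> y \<squnion> z\<close>] A(1) c(1) J(1) by blast
    then have "x \<sqinter> (y \<squnion> z) = ?a \<or> x \<sqinter> (y \<squnion> z) = y \<squnion> z"
      using covers_between[OF cov M(1) _ M(3)] by blast
    moreover have "x \<sqinter> (y \<squnion> z) \<noteq> y \<squnion> z"
      using False le_trans[OF J(3)] M(2) z(1) J(1) c(1) by metis
    ultimately show ?thesis using A(1) by auto
  qed
qed

lemma modular_bounded:
  assumes x: "x \<in> carrier L" and y: "y \<in> carrier L" "y \<sqsubseteq> x"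
    and z: "z \<in> carrier L" and u: "u \<in> carrier L" "x \<sqsubseteq> u" "z \<sqsubseteq> u"
  shows "x \<sqinter> (y \<squnion> z) \<sqsubseteq> y \<squnion> (x \<sqinter> z)"
proof -
  let ?F = "\<lambda>w. y \<squnion> (w \<sqinter> z)"
  have yu: "y \<sqsubseteq> u" using le_trans[OF y(2) u(2)] x y(1) u(1) by simp
  have m: "w \<sqinter> z \<in> carrier L" "w \<sqinter> z \<sqsubseteq> w" "w \<sqinter> z \<sqsubseteq> z" "w \<sqinter> z \<sqsubseteq> u" if "w \<in> carrier L" for w
    using that z u meet_left meet_right meet_closed le_trans[of "w \<sqinter> z" z u] by auto
  have F: "?F w \<in> carrier L" if "w \<in> carrier L" for w
    using bounded_join_closed[OF y(1) m(1) u(1) yu m(4)] that by blast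
  let ?r = "?F x"
  \<comment> \<open>For \<open>w = x\<close> the last condition is trivial; for \<open>w = u\<close>
    it is the claim, because \<open>u \<sqinter> z = z\<close>.\<close>
  define K where "K = {w \<in> carrier L. x \<sqsubseteq> w \<and> w \<sqsubseteq> u \<and> x \<sqinter> ?F w \<sqsubseteq> ?r}"
  have "x \<in> K"
    using x u(2) F meet_right by (simp add: K_def)
  moreover have "\<exists>v\<in>K. \<forall>c\<in>C. c \<sqsubseteq> v" if C: "C \<in> chains L" "C \<subseteq> K" for C
  proof -
    obtain s where s: "least L s (Upper L C)"
      using chain_lub[OF C(1)] .
    note sD = least_UpperD[OF s]
    have c: "c \<in> carrier L" "x \<sqsubseteq> c" "c \<sqsubseteq> u" "x \<sqinter> ?F c \<sqsubseteq> ?r" "c \<sqsubseteq> s" if "c \<in> C" for c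
      using that C(2) sD(2) by (auto simp: K_def)
    obtain c0 where "c0 \<in> C" using chainsD(2)[OF C(1)] by blast
    then have xs: "x \<sqsubseteq> s" using le_trans[OF c(2) c(5)] x c(1) sD(1) by simp
    have su: "s \<sqsubseteq> u" using sD(3)[OF u(1)] c(3) by blast
    \<comment> \<open>Meeting with \<open>z\<close>, joining with \<open>y\<close> and meeting with
      \<open>x\<close> each preserve suprema of chains, so the condition passes from the members of
      \<open>C\<close> to \<open>s\<close>.\<close>
    have "(\<sqinter>) z ` C \<in> chains L"
    proof (rule chains_image[OF C(1)])
      show "z \<sqinter> c \<in> carrier L" if "c \<in> C" for c using that c z by simp
      show "z \<sqinter> c \<sqsubseteq> z \<sqinter> d" if "c \<in> C" "d \<in> C" "c \<sqsubseteq> d" for c d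
        using that c(1) z le_trans[of "z \<sqinter> c" c d] meet_right meet_left
        by (intro meet_le) auto
    qed
    moreover have "least L (z \<sqinter> s) (Upper L ((\<sqinter>) z ` C))"
      using meet_least[OF z C(1) s] .
    moreover have "z \<sqinter> s \<in> carrier L" "z \<sqinter> s \<sqsubseteq> u"
      using m(1,4)[OF sD(1)] meet_comm by metis+
    ultimately have "(\<squnion>) y ` (\<sqinter>) z ` C \<in> chains L"
        "least L (y \<squnion> (z \<sqinter> s)) (Upper L ((\<squnion>) y ` (\<sqinter>) z ` C))"
      using join_chain_least[OF y(1)] u(1) yu by blast+
    from meet_least[OF x this]
    have "least L (x \<sqinter> ?F s) (Upper L ((\<lambda>c. x \<sqinter> ?F c) ` C))"
      by (simp add: image_image meet_comm[of L z])
    then have "x \<sqinter> ?F s \<sqsubseteq> ?r"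
      by (rule least_UpperD(3)) (use F[OF x] c(4) in auto)
    then have "s \<in> K" using sD(1) xs su by (simp add: K_def)
    then show ?thesis using c(5) by blast
  qed
  moreover have "K \<subseteq> carrier L" by (auto simp: K_def)
  ultimately obtain w where w: "w \<in> K" and max: "\<And>v. v \<in> K \<Longrightarrow> w \<sqsubseteq> v \<Longrightarrow> v = w"
    using exists_maximal[of K x] by blast
  have wc: "w \<in> carrier L" "x \<sqsubseteq> w" "w \<sqsubseteq> u" "x \<sqinter> ?F w \<sqsubseteq> ?r"
    using w by (auto simp: K_def)
  have "w = u"
  proof (rule ccontr)
    assume "w \<noteq> u"
    then have "w \<sqsubset> u" using wc(3) by (simp add: lless_eq)
    then obtain v where v: "v \<in> carrier L" "w \<lessdot> v" "v \<sqsubseteq> u"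
      using weakly_atomic wc(1) u(1) by blast
    have wv: "w \<sqsubseteq> v" using coversD(3)[OF v(2)] .
    have yw: "y \<sqsubseteq> w" using le_trans[OF y(2) wc(2)] y x wc(1) by simp
    \<comment> \<open>\<open>modular_below_cover\<close>, used for \<open>w\<close> covered by
      \<open>v\<close> and for \<open>v \<sqinter> z\<close>, gives
      \<open>w \<sqinter> ?F v \<sqsubseteq> ?F w\<close>. As \<open>x \<sqsubseteq> w\<close>, it
      follows that \<open>x \<sqinter> ?F v\<close> is below \<open>x \<sqinter> ?F w\<close>, hence
      below \<open>?r\<close>, and \<open>v\<close> is in \<open>K\<close>.\<close>
    have "w \<sqinter> (v \<sqinter> z) = w \<sqinter> z"
    proof (rule le_antisym)
      show "w \<sqinter> (v \<sqinter> z) \<sqsubseteq> w \<sqinter> z"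
        using wc(1) m[OF v(1)] z meet_left meet_right
          le_trans[of "w \<sqinter> (v \<sqinter> z)" "v \<sqinter> z" z] by (intro meet_le) auto
      show "w \<sqinter> z \<sqsubseteq> w \<sqinter> (v \<sqinter> z)"
        using wc(1) m[OF wc(1)] m[OF v(1)] z v(1) wv le_trans[of "w \<sqinter> z" w v]
        by (intro meet_le) auto
    qed (use wc(1) m v(1) in auto)
    then have wF: "w \<sqinter> ?F v \<sqsubseteq> ?F w"
      using modular_below_cover[OF v(2) y(1) yw m(1,2)[OF v(1)]] by simp
    have xv: "x \<sqsubseteq> v" using le_trans[OF wc(2) wv] x wc(1) v(1) by simp
    have l: "x \<sqinter> ?F v \<in> carrier L" "x \<sqinter> ?F v \<sqsubseteq> x" "x \<sqinter> ?F v \<sqsubseteq> ?F v"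
      using x F[OF v(1)] meet_left meet_right by auto
    have "x \<sqinter> ?F v \<sqsubseteq> w" using le_trans[OF l(2) wc(2)] l(1) x wc(1) by simp
    then have "x \<sqinter> ?F v \<sqsubseteq> w \<sqinter> ?F v"
      using meet_le l(1,3) wc(1) F[OF v(1)] by blast
    then have "x \<sqinter> ?F v \<sqsubseteq> ?F w"
      using le_trans[OF _ wF] l(1) F[OF v(1)] F[OF wc(1)] wc(1) by simp
    then have "x \<sqinter> ?F v \<sqsubseteq> x \<sqinter> ?F w"
      using meet_le l(1,2) x F[OF wc(1)] by blast
    then have "x \<sqinter> ?F v \<sqsubseteq> ?r"
      using le_trans[OF _ wc(4)] l(1) x F[OF wc(1)] F[OF x] by simp
    then have "v \<in> K" using v xv by (simp add: K_def)
    then have "v = w" using max wv by blast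
    then show False using v(2) not_covers_self by blast
  qed
  moreover have "u \<sqinter> z = z"
    using m[OF u(1)] meet_le[of z u z] z u by (intro le_antisym) auto
  ultimately show ?thesis using wc(4) by simp
qed

text \<open>\<open>x\<close> and \<open>z\<close> may have no common upper bound, so
  \<open>modular_bounded\<close> is applied to \<open>x \<sqinter> (y \<squnion> z)\<close> in place
  of \<open>x\<close>. This element is bounded by \<open>y \<squnion> z\<close> and has the same
  meet with \<open>z\<close> as \<open>x\<close>.\<close>

lemma conditionally_modular: "conditionally_modular L"
  unfolding conditionally_modular_def
proof (intro ballI impI, elim conjE)
  fix x y z
  assume x: "x \<in> carrier L" and y: "y \<in> carrier L" and z: "z \<in> carrier L"
    and "Upper L {y, z} \<noteq> {}" and yx: "y \<sqsubseteq> x"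
  then obtain b where "b \<in> carrier L" "y \<sqsubseteq> b" "z \<sqsubseteq> b"
    by (auto simp: Upper_def)
  note b = y z this
  let ?j = "y \<squnion> z"
  note j = bounded_join_closed[OF b] bounded_join_left[OF b] bounded_join_right[OF b]
  let ?u = "x \<sqinter> ?j"
  have u: "?u \<in> carrier L" "?u \<sqsubseteq> x" "?u \<sqsubseteq> ?j" "y \<sqsubseteq> ?u"
    using x y yx j meet_left meet_right meet_le by auto
  have m: "x \<sqinter> z \<in> carrier L" "x \<sqinter> z \<sqsubseteq> x" "x \<sqinter> z \<sqsubseteq> z"
    using x z meet_left meet_right by auto
  have "x \<sqinter> z \<sqsubseteq> ?j" using le_trans[OF m(3) j(3)] m(1) z j(1) by simp
  then have mu: "x \<sqinter> z \<sqsubseteq> ?u" using meet_le m x j(1) by blast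
  have uz: "?u \<sqinter> z = x \<sqinter> z"
  proof (rule le_antisym)
    show "x \<sqinter> z \<sqsubseteq> ?u \<sqinter> z"
      using meet_le[OF mu m(3)] m(1) u(1) z by blast
    show "?u \<sqinter> z \<sqsubseteq> x \<sqinter> z"
      using u z x meet_left meet_right le_trans[of "?u \<sqinter> z" ?u x] by (intro meet_le) auto
  qed (use u z m in auto)
  have "?u \<sqinter> ?j = ?u"
    using u j(1) meet_left meet_le[of ?u ?u ?j] by (intro le_antisym) auto
  then have "?u \<sqsubseteq> y \<squnion> (x \<sqinter> z)"
    using modular_bounded[OF u(1) y u(4) z j(1) u(3) j(3)] uz by simp
  moreover have "y \<squnion> (x \<sqinter> z) \<sqsubseteq> ?u"
    using bounded_join_le[OF y m(1) u(1,4) mu] .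
  ultimately have "?u = y \<squnion> (x \<sqinter> z)"
    using bounded_join_closed[OF y m(1) u(1,4) mu] u(1) by (intro le_antisym)
  then have "least L ?u (Upper L {y, x \<sqinter> z})"
    using least_join[OF y m(1) u(1,4) mu] by simp
  moreover have "greatest L (x \<sqinter> z) (Lower L {x, z})" "greatest L ?u (Lower L {x, ?j})"
    using inf_of_two_greatest x z j(1) by (simp_all add: meet_def)
  ultimately show "\<exists>j m u. least L j (Upper L {y, z}) \<and> greatest L m (Lower L {x, z}) \<and>
      greatest L u (Lower L {x, j}) \<and> least L u (Upper L {y, m})"
    using least_join[OF b] by blast
qed

end


section \<open>The poset of states\<close>

lemma Bot_le_outcome [simp]: "Bot \<le> v"
  by (simp add: less_eq_outcome_def)

context state_data
begin

sublocale S: partial_order S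
  by (rule partial_order_state_poset)

lemma le_state_iff: "\<sigma> \<sqsubseteq>\<^bsub>S\<^esub> \<tau> \<longleftrightarrow> (\<forall>t\<in>T. state_eval e t \<sigma> \<le> state_eval e t \<tau>)"
  by (simp add: state_poset_def)

lemma class_closed: "p \<in> P \<Longrightarrow> prep_equiv P T e `` {p} \<in> carrier S"
  by (simp add: state_poset_def quotientI)

lemma stateE:
  assumes "\<sigma> \<in> carrier S"
  obtains p where "p \<in> P" "\<sigma> = prep_equiv P T e `` {p}"
  using assms by (auto simp: state_poset_def elim: quotientE)

lemma state_eval_bar:
  assumes "\<sigma> \<in> carrier S" "t \<in> T"
  shows "state_eval e (bar t) \<sigma> = flip (state_eval e t \<sigma>)"
proof -
  obtain p where "p \<in> P" "\<sigma> = prep_equiv P T e `` {p}"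
    using assms(1) by (rule stateE)
  moreover have "bar t \<in> T" using bar_closed assms(2) by blast
  ultimately show ?thesis
    using assms(2) by (simp add: state_eval_class eval_bar)
qed

end

section \<open>Infima, suprema and continuity of evaluation in the poset of states\<close>

context state_system
begin

text \<open>(A1) is applied to all preparations whose class lies in \<open>A\<close>. The order is
  defined testwise, so the class of their infimum is the infimum of \<open>A\<close>.\<close>

lemma infimum_exists:
  assumes A: "A \<subseteq> carrier S" "A \<noteq> {}"
  obtains m where "greatest S m (Lower S A)"
    "\<And>t. t \<in> T \<Longrightarrow> state_eval e t m = \<Sqinter>\<^sub>f\<^sub>i\<^sub>n (state_eval e t ` A)"
proof -
  let ?cls = "\<lambda>p. prep_equiv P T e `` {p}"
  define Q where "Q = {p \<in> P. ?cls p \<in> A}"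
  have A_eq: "A = ?cls ` Q"
  proof
    show "A \<subseteq> ?cls ` Q"
    proof
      fix a assume a: "a \<in> A"
      then obtain p where "p \<in> P" "a = ?cls p"
        using A(1) stateE by blast
      then show "a \<in> ?cls ` Q" using a by (simp add: Q_def)
    qed
  qed (auto simp: Q_def)
  then have "Q \<noteq> {}" using A(2) by blast
  then obtain q where q: "q \<in> P" "\<And>t. t \<in> T \<Longrightarrow> e q t = \<Sqinter>\<^sub>f\<^sub>i\<^sub>n ((\<lambda>p. e p t) ` Q)"
    using A1[of Q] by (auto simp: Q_def)
  have "state_eval e t ` A = (\<lambda>p. e p t) ` Q" if "t \<in> T" for t
    unfolding A_eq image_image
    using that by (intro image_cong) (auto simp: Q_def state_eval_class)
  then have ev: "state_eval e t (?cls q) = \<Sqinter>\<^sub>f\<^sub>i\<^sub>n (state_eval e t ` A)" if "t \<in> T" for t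
    using that q by (simp add: state_eval_class)
  have "greatest S (?cls q) (Lower S A)"
  proof (rule greatest_LowerI)
    show "?cls q \<sqsubseteq>\<^bsub>S\<^esub> a" if "a \<in> A" for a
      using that by (auto simp: le_state_iff ev intro!: Inf_fin.coboundedI)
    show "y \<sqsubseteq>\<^bsub>S\<^esub> ?cls q" if "y \<in> Lower S A" for y
    proof -
      have "y \<sqsubseteq>\<^bsub>S\<^esub> a" if "a \<in> A" for a
        using \<open>y \<in> Lower S A\<close> that A(1) by (auto simp: Lower_def)
      then show ?thesis
        using A(2) by (auto simp: le_state_iff ev intro!: Inf_fin.boundedI)
    qed
  qed (use A(1) q(1) class_closed in auto)
  then show thesis using that ev by blast
qed

sublocale S: lower_semilattice S
proof
  fix x y assume "x \<in> carrier S" "y \<in> carrier S"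
  then show "\<exists>s. greatest S s (Lower S {x, y})"
    using infimum_exists[of "{x, y}"] by blast
qed

lemma state_eval_meet:
  assumes "x \<in> carrier S" "y \<in> carrier S" "t \<in> T"
  shows "state_eval e t (x \<sqinter>\<^bsub>S\<^esub> y) =
    (if state_eval e t x = state_eval e t y then state_eval e t x else Bot)"
proof -
  obtain m where m: "greatest S m (Lower S {x, y})"
    "\<And>t. t \<in> T \<Longrightarrow> state_eval e t m = \<Sqinter>\<^sub>f\<^sub>i\<^sub>n (state_eval e t ` {x, y})"
    using infimum_exists[of "{x, y}"] assms by blast
  have "m = x \<sqinter>\<^bsub>S\<^esub> y"
    using S.greatest_unique[OF m(1)] S.inf_of_two_greatest[OF assms(1,2)] by (simp add: meet_def)
  then show ?thesis
    using m(2)[OF assms(3)] by (auto simp: inf_outcome_def)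
qed

sublocale S: weak_partial_order_bottom S
proof
  obtain q where q: "q \<in> P" "\<And>t. t \<in> T \<Longrightarrow> e q t = Bot"
    using A2 by blast
  let ?q = "prep_equiv P T e `` {q}"
  have "least S ?q (carrier S)"
    using q class_closed by (auto simp: least_def le_state_iff state_eval_class)
  then show "\<exists>x. least S x (carrier S)" ..
qed

text \<open>The supremum is the infimum of the upper bounds; boundedness makes that set nonempty, as
  \<open>infimum_exists\<close> demands.\<close>

lemma bounded_complete_states: "bounded_complete S"
proof -
  have "\<exists>s. least S s (Upper S A)" if A: "A \<subseteq> carrier S" "Upper S A \<noteq> {}" for A
  proof -
    obtain m where m: "greatest S m (Lower S (Upper S A))"
      using infimum_exists[OF Upper_closed A(2)] by blast
    have "least S m (Upper S A)"
    proof (rule least_UpperI[OF _ _ A(1)])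
      show "m \<in> carrier S" using m by (rule greatest_closed)
      show "x \<sqsubseteq>\<^bsub>S\<^esub> m" if "x \<in> A" for x
        using that A(1) m by (auto simp: greatest_def intro!: Lower_memI)
      show "m \<sqsubseteq>\<^bsub>S\<^esub> y" if "y \<in> Upper S A" for y
        using greatest_Lower_below[OF m that] by blast
    qed
    then show ?thesis ..
  qed
  then show ?thesis by (simp add: bounded_complete_def)
qed

text \<open>(A4) speaks of the value \<open>Yes\<close>; the value \<open>No\<close> is reduced to
  it through the conjugate test \<open>bar t\<close>.\<close>

lemma state_eval_chain_lub:
  assumes C: "C \<in> chains S" and s: "least S s (Upper S C)"
    and t: "t \<in> T" "state_eval e t s \<noteq> Bot"
  shows "\<exists>\<sigma>\<in>C. state_eval e t \<sigma> = state_eval e t s"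
proof (cases "state_eval e t s")
  case Bot
  then show ?thesis using t by simp
next
  case Yes
  then show ?thesis using A4[OF t(1) C s] by simp
next
  case No
  have "state_eval e (bar t) s = Yes"
    using state_eval_bar[OF least_closed[OF s] t(1)] No by simp
  then obtain \<sigma> where \<sigma>: "\<sigma> \<in> C" "state_eval e (bar t) \<sigma> = Yes"
    using A4[OF _ C s] bar_closed t(1) by blast
  then have "flip (state_eval e t \<sigma>) = Yes"
    using state_eval_bar chainsD(1)[OF C] t(1) by auto
  then have "state_eval e t \<sigma> = No" by (cases "state_eval e t \<sigma>") auto
  then show ?thesis using \<sigma>(1) No by auto
qed

text \<open>Checked test by test. Where \<open>x \<sqinter> s\<close> has a value other than
  \<open>Bot\<close>, \<open>x\<close> and \<open>s\<close> share that value. Some \<open>d\<close>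
  in \<open>C\<close> attains it, hence so does \<open>x \<sqinter> d\<close>, and with it every
  upper bound of the meets.\<close>

lemma meet_continuous_states: "meet_continuous S"
  unfolding meet_continuous_def
proof (intro ballI)
  fix x C assume x: "x \<in> carrier S" and C: "C \<in> chains S"
  obtain s where s: "least S s (Upper S C)"
    using A3[OF C] by blast
  note sD = least_UpperD[OF s]
  have c: "c \<in> carrier S" if "c \<in> C" for c
    using that chainsD(1)[OF C] by blast
  have "least S (x \<sqinter>\<^bsub>S\<^esub> s) (Upper S ((\<lambda>c. x \<sqinter>\<^bsub>S\<^esub> c) ` C))"
  proof (rule least_UpperI)
    fix z assume "z \<in> (\<lambda>c. x \<sqinter>\<^bsub>S\<^esub> c) ` C"
    then obtain d where d: "d \<in> C" "z = x \<sqinter>\<^bsub>S\<^esub> d" by blast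
    have "x \<sqinter>\<^bsub>S\<^esub> d \<sqsubseteq>\<^bsub>S\<^esub> s"
      using S.le_trans[OF S.meet_right[OF x c[OF d(1)]] sD(2)] x c d(1) sD(1) by simp
    then show "z \<sqsubseteq>\<^bsub>S\<^esub> x \<sqinter>\<^bsub>S\<^esub> s"
      using S.meet_le[OF S.meet_left] x c[OF d(1)] sD(1) d(2) by simp
  next
    fix u assume u: "u \<in> Upper S ((\<lambda>c. x \<sqinter>\<^bsub>S\<^esub> c) ` C)"
    have "state_eval e t (x \<sqinter>\<^bsub>S\<^esub> s) \<le> state_eval e t u" if t: "t \<in> T" for t
    proof (cases "state_eval e t (x \<sqinter>\<^bsub>S\<^esub> s) = Bot")
      case False
      then have eq: "state_eval e t x = state_eval e t s" "state_eval e t s \<noteq> Bot"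
          "state_eval e t (x \<sqinter>\<^bsub>S\<^esub> s) = state_eval e t s"
        using state_eval_meet[OF x sD(1) t] by (auto split: if_splits)
      then obtain d where d: "d \<in> C" "state_eval e t d = state_eval e t s"
        using state_eval_chain_lub[OF C s t] by blast
      have "x \<sqinter>\<^bsub>S\<^esub> d \<sqsubseteq>\<^bsub>S\<^esub> u"
        using u d(1) x c by auto
      then show ?thesis
        using state_eval_meet[OF x c[OF d(1)] t] d(2) eq t by (auto simp: le_state_iff)
    qed simp
    then show "x \<sqinter>\<^bsub>S\<^esub> s \<sqsubseteq>\<^bsub>S\<^esub> u" by (simp add: le_state_iff)
  qed (use x c sD(1) in auto)
  moreover have "greatest S (x \<sqinter>\<^bsub>S\<^esub> y) (Lower S {x, y})" if "y \<in> carrier S" for y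
    using S.inf_of_two_greatest[OF x that] by (simp add: meet_def)
  ultimately show "\<exists>s m g. least S s (Upper S C) \<and> greatest S m (Lower S {x, s}) \<and>
      (\<forall>c\<in>C. greatest S (g c) (Lower S {x, c})) \<and> least S m (Upper S (g ` C))"
    using s sD(1) c by blast
qed

sublocale S: meet_continuous_semilattice S
  by unfold_locales (rule bounded_complete_states meet_continuous_states)+

sublocale S: covering_semilattice S
proof
  show "\<exists>z\<in>carrier S. x \<lessdot>\<^bsub>S\<^esub> z \<and> z \<sqsubseteq>\<^bsub>S\<^esub> y"
    if "x \<in> carrier S" "y \<in> carrier S" "x \<sqsubset>\<^bsub>S\<^esub> y" for x y
    using that by (rule A5)
  show "x \<sqinter>\<^bsub>S\<^esub> y \<lessdot>\<^bsub>S\<^esub> x"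
    if asm: "x \<in> carrier S" "x \<sqsubseteq>\<^bsub>S\<^esub> w" "y \<lessdot>\<^bsub>S\<^esub> w" "\<not> x \<sqsubseteq>\<^bsub>S\<^esub> y" for x y w
  proof -
    have y: "y \<in> carrier S" "w \<in> carrier S" using coversD[OF asm(3)] by simp_all
    obtain m where m: "greatest S m (Lower S {x, y})" "m \<lessdot>\<^bsub>S\<^esub> x"
      using A6b[OF asm(1) y asm(2-4)] by blast
    have "m = x \<sqinter>\<^bsub>S\<^esub> y"
      using S.greatest_unique[OF m(1)] S.inf_of_two_greatest[OF asm(1) y(1)]
      by (simp add: meet_def)
    then show ?thesis using m(2) by simp
  qed
  show "y \<lessdot>\<^bsub>S\<^esub> y \<squnion>\<^bsub>S\<^esub> z"
    if asm: "y \<in> carrier S" "u \<in> carrier S" "x \<sqsubseteq>\<^bsub>S\<^esub> y" "y \<sqsubseteq>\<^bsub>S\<^esub> u" "x \<lessdot>\<^bsub>S\<^esub> z" "z \<sqsubseteq>\<^bsub>S\<^esub> u"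
      "\<not> z \<sqsubseteq>\<^bsub>S\<^esub> y" for x y z u
  proof -
    have c: "x \<in> carrier S" "z \<in> carrier S" using coversD[OF asm(5)] by simp_all
    obtain j where j: "least S j (Upper S {y, z})" "y \<lessdot>\<^bsub>S\<^esub> j"
      using A6c[OF c(1) asm(1) c(2) asm(2-7)] by blast
    \<comment> \<open>The bound \<open>u\<close> guarantees that the chosen join is a supremum, so
      it coincides with the witness from (A6)(c).\<close>
    have "j = y \<squnion>\<^bsub>S\<^esub> z"
      using S.least_unique[OF j(1) S.least_join[OF asm(1) c(2) asm(2,4,6)]] .
    then show ?thesis using j(2) by simp
  qed
qed

lemma atomistic_states: "atomistic S"
  using S.atomistic[OF A5 A6a] .

lemma projective_domain_states: "projective_domain S"
  by unfold_locales
    (rule S.directed_complete bounded_complete_states atomistic_states meet_continuous_states A6a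
      S.conditionally_modular)+

end

theorem theorem2:
  fixes P :: "'p set" and T :: "'t set" and e :: "'p \<Rightarrow> 't \<Rightarrow> outcome" and bar :: "'t \<Rightarrow> 't"
  assumes "state_system P T e bar"
  shows "projective_domain (state_poset P T e) \<and> algebraic (state_poset P T e)"
proof -
  interpret state_system P T e bar by (rule assms)
  show ?thesis
    using projective_domain_states S.algebraic_if_atomistic[OF atomistic_states] by blast
qed

end
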